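(* Let $\Phi=(A;\{E_i\}_{i=0}^d;A^*;\{E_i^*\}_{i=0}^d)$ be a tridiagonal system of diameter $d\geq 1$ on $V$ over $\mathbb{K}$, with second split decomposition $\{U_i^{\Downarrow}\}_{i=0}^d$, and let $\Delta\in\mathrm{End}(V)$ be the linear transformation attached to $\Phi$ as defined in the context. Then $$(\Delta-I)U_i^{\Downarrow}\subseteq U_0^{\Downarrow}+U_1^{\Downarrow}+\cdots+U_{i-1}^{\Downarrow}\qquad(0\le i\le d).$$
   Context: $\mathbb{K}$ is a field, $V$ is a $\mathbb{K}$-vector space of finite positive dimension, $\mathrm{End}(V)$ is the algebra of linear maps $V\to V$, and $I$ is the identity. A tridiagonal pair (TD pair) on $V$ is an ordered pair $A,A^*\in\mathrm{End}(V)$ ($A^*$ is just a name, not an adjoint) such that: (i) $A$ and $A^*$ are each diagonalizable over $\mathbb{K}$; (ii) there is an ordering $\{V_i\}_{i=0}^d$ of the eigenspaces of $A$ with $A^*V_i\subseteq V_{i-1}+V_i+V_{i+1}$ for $0\le i\le d$, where $V_{-1}=V_{d+1}=0$; (iii) there is an ordering $\{V_i^*\}_{i=0}^{\delta}$ of the eigenspaces of $A^*$ with $AV_i^*\subseteq V_{i-1}^*+V_i^*+V_{i+1}^*$ for $0\le i\le\delta$, where $V_{-1}^*=V_{\delta+1}^*=0$; (iv) there is no subspace $W$ of $V$ with $AW\subseteq W$, $A^*W\subseteq W$, $W\ne0$, $W\ne V$. It is known that $d=\delta$; this is the diameter, and it is assumed that $d\ge1$. Orderings satisfying (ii) (resp.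 (iii)) are called standard. The primitive idempotent of a diagonalizable map associated with one of its eigenspaces is the projection of $V$ onto that eigenspace that kills the other eigenspaces. A tridiagonal system (TD system) on $V$ is a sequence $\Phi=(A;\{E_i\}_{i=0}^d;A^*;\{E_i^*\}_{i=0}^d)$ where $A,A^*$ is a TD pair on $V$, $\{E_i\}_{i=0}^d$ is an ordering of the primitive idempotents of $A$ such that $\{E_iV\}_{i=0}^d$ is standard, and $\{E_i^*\}_{i=0}^d$ is an ordering of the primitive idempotents of $A^*$ such that $\{E_i^*V\}_{i=0}^d$ is standard. For $0\le i\le d$ set $U_i=(E_0^*V+\cdots+E_i^*V)\cap(E_iV+\cdots+E_dV)$ and $U_i^{\Downarrow}=(E_0^*V+\cdots+E_i^*V)\cap(E_0V+\cdots+E_{d-i}V)$. It is known that $V=\bigoplus_{i=0}^dU_i=\bigoplus_{i=0}^dU_i^{\Downarrow}$ (first and second split decompositions). Let $F_i$ be the projection of $V$ onto $U_i$ along $\bigoplus_{j\ne i}U_j$, and $F_i^{\Downarrow}$ the projection of $V$ onto $U_i^{\Downarrow}$ along $\bigoplus_{j\ne i}U_j^{\Downarrow}$. Define $\Delta=\sum_{h=0}^dF_h^{\Downarrow}F_h$. An empty sum of subspaces is $0$. *)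

theory Defs
  imports Complex_Main "HOL-Library.Set_Algebras"
begin

text \<open>
  The space \<open>V\<close> is a whole type \<open>'v\<close> with scalar multiplication \<open>s\<close>. Sums of subspaces are
  the elementwise sums of \<^theory>\<open>HOL-Library.Set_Algebras\<close>; in particular an empty sum of
  subspaces is \<open>{0}\<close>.
\<close>

type_synonym ('k, 'v) scaling = "'k \<Rightarrow> 'v \<Rightarrow> 'v"

definition eigenspace ::
    "('k::field, 'v::ab_group_add) scaling \<Rightarrow> ('v \<Rightarrow> 'v) \<Rightarrow> 'k \<Rightarrow> 'v set" where
  "eigenspace s A \<theta> = {v. A v = s \<theta> v}"

definition eigenvalue ::
    "('k::field, 'v::ab_group_add) scaling \<Rightarrow> ('v \<Rightarrow> 'v) \<Rightarrow> 'k \<Rightarrow> bool" where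
  "eigenvalue s A \<theta> \<longleftrightarrow> (\<exists>v. v \<noteq> 0 \<and> A v = s \<theta> v)"

definition eigenspaces ::
    "('k::field, 'v::ab_group_add) scaling \<Rightarrow> ('v \<Rightarrow> 'v) \<Rightarrow> 'v set set" where
  "eigenspaces s A = {eigenspace s A \<theta> | \<theta>. eigenvalue s A \<theta>}"

definition diagonalizable ::
    "('k::field, 'v::ab_group_add) scaling \<Rightarrow> ('v \<Rightarrow> 'v) \<Rightarrow> bool" where
  "diagonalizable s A \<longleftrightarrow> module.span s (\<Union>(eigenspaces s A)) = UNIV"

text \<open>
  \<open>W 0, \<dots>, W d\<close> is an ordering of the eigenspaces of \<open>A\<close> on which \<open>B\<close> acts in a block
  tridiagonal fashion. The two conditionals supply the conventions \<open>W\<^sub>-\<^sub>1 = 0\<close> and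
  \<open>W\<^sub>d\<^sub>+\<^sub>1 = 0\<close>.
\<close>

definition standard_ordering ::
    "('k::field, 'v::ab_group_add) scaling \<Rightarrow> ('v \<Rightarrow> 'v) \<Rightarrow> ('v \<Rightarrow> 'v) \<Rightarrow> nat \<Rightarrow> (nat \<Rightarrow> 'v set) \<Rightarrow> bool"
  where
  "standard_ordering s A B d W \<longleftrightarrow>
     bij_betw W {0..d} (eigenspaces s A) \<and>
     (\<forall>i\<le>d. B ` W i \<subseteq>
        (if i = 0 then {0} else W (i - 1)) + W i + (if i = d then {0} else W (i + 1)))"

definition td_pair ::
    "('k::field, 'v::ab_group_add) scaling \<Rightarrow> ('v \<Rightarrow> 'v) \<Rightarrow> ('v \<Rightarrow> 'v) \<Rightarrow> bool" where
  "td_pair s A As \<longleftrightarrow>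
     Vector_Spaces.linear s s A \<and> Vector_Spaces.linear s s As \<and>
     diagonalizable s A \<and> diagonalizable s As \<and>
     (\<exists>d W. standard_ordering s A As d W) \<and>
     (\<exists>\<delta> Ws. standard_ordering s As A \<delta> Ws) \<and>
     \<not> (\<exists>W. module.subspace s W \<and> A ` W \<subseteq> W \<and> As ` W \<subseteq> W \<and> W \<noteq> {0} \<and> W \<noteq> UNIV)"

text \<open>
  \<open>P\<close> is a projection onto \<open>W\<close> killing every vector of \<open>K\<close>. If \<open>W\<close> and the span of \<open>K\<close>
  are complementary subspaces, there is exactly one such \<open>P\<close>.
\<close>

definition is_projection ::
    "('k::field, 'v::ab_group_add) scaling \<Rightarrow> ('v \<Rightarrow> 'v) \<Rightarrow> 'v set \<Rightarrow> 'v set \<Rightarrow> bool" where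
  "is_projection s P W K \<longleftrightarrow>
     Vector_Spaces.linear s s P \<and> range P = W \<and> P \<circ> P = P \<and> (\<forall>v\<in>K. P v = 0)"

definition primitive_idempotents ::
    "('k::field, 'v::ab_group_add) scaling \<Rightarrow> ('v \<Rightarrow> 'v) \<Rightarrow> ('v \<Rightarrow> 'v) set" where
  "primitive_idempotents s A =
     {P. \<exists>W\<in>eigenspaces s A. is_projection s P W (\<Union>(eigenspaces s A - {W}))}"

definition td_system ::
    "('k::field, 'v::ab_group_add) scaling \<Rightarrow> ('v \<Rightarrow> 'v) \<Rightarrow> (nat \<Rightarrow> 'v \<Rightarrow> 'v) \<Rightarrow>
     ('v \<Rightarrow> 'v) \<Rightarrow> (nat \<Rightarrow> 'v \<Rightarrow> 'v) \<Rightarrow> nat \<Rightarrow> bool" where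
  "td_system s A E As Es d \<longleftrightarrow>
     td_pair s A As \<and>
     bij_betw E {0..d} (primitive_idempotents s A) \<and>
     standard_ordering s A As d (\<lambda>i. range (E i)) \<and>
     bij_betw Es {0..d} (primitive_idempotents s As) \<and>
     standard_ordering s As A d (\<lambda>i. range (Es i))"


definition split1 ::
    "(nat \<Rightarrow> 'v \<Rightarrow> 'v) \<Rightarrow> (nat \<Rightarrow> 'v \<Rightarrow> 'v) \<Rightarrow> nat \<Rightarrow> nat \<Rightarrow> 'v::ab_group_add set" where
  "split1 E Es d i = (\<Sum>j\<in>{0..i}. range (Es j)) \<inter> (\<Sum>j\<in>{i..d}. range (E j))"

definition split2 ::
    "(nat \<Rightarrow> 'v \<Rightarrow> 'v) \<Rightarrow> (nat \<Rightarrow> 'v \<Rightarrow> 'v) \<Rightarrow> nat \<Rightarrow> nat \<Rightarrow> 'v::ab_group_add set" where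
  "split2 E Es d i = (\<Sum>j\<in>{0..i}. range (Es j)) \<inter> (\<Sum>j\<in>{0..d - i}. range (E j))"

text \<open>
  The projection onto \<open>U i\<close> along the sum of the other \<open>U j\<close>; it is meaningful when the
  space is the direct sum of \<open>U 0, \<dots>, U d\<close>.
\<close>

definition decomp_proj ::
    "('k::field, 'v::ab_group_add) scaling \<Rightarrow> nat \<Rightarrow> (nat \<Rightarrow> 'v set) \<Rightarrow> nat \<Rightarrow> 'v \<Rightarrow> 'v" where
  "decomp_proj s d U i = (THE P. is_projection s P (U i) (\<Sum>j\<in>{0..d} - {i}. U j))"

definition Delta ::
    "('k::field, 'v::ab_group_add) scaling \<Rightarrow> (nat \<Rightarrow> 'v \<Rightarrow> 'v) \<Rightarrow> (nat \<Rightarrow> 'v \<Rightarrow> 'v) \<Rightarrow> nat \<Rightarrow> 'v \<Rightarrow> 'v"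
  where
  "Delta s E Es d v =
     (\<Sum>h\<in>{0..d}. decomp_proj s d (split2 E Es d) h (decomp_proj s d (split1 E Es d) h v))"

end

theory Submission
  imports Defs
begin

text \<open>
  Put \<open>X i = E\<^sup>*\<^sub>0V + \<dots> + E\<^sup>*\<^sub>i\<^sub>-\<^sub>1V\<close>, \<open>Y i = E\<^sub>iV + \<dots> + E\<^sub>dV\<close> and
  \<open>Z i = E\<^sub>0V + \<dots> + E\<^sub>d\<^sub>-\<^sub>iV\<close>. The two split decompositions have the summands
  \<open>X (i+1) \<inter> Y i\<close> and \<open>X (i+1) \<inter> Z i\<close>, and the point is that they induce the same
  filtration: the first \<open>i\<close> summands of either one add up to \<open>X i\<close>.

  Granting this, let \<open>v\<close> lie in the \<open>i\<close>-th summand of the second decomposition, hence in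
  \<open>X (i+1)\<close>. Then \<open>F\<^sub>h v = 0\<close> for \<open>h > i\<close>, and \<open>F\<^sub>i v\<close> differs from \<open>v\<close> by an element of
  \<open>X i\<close>, which the projection \<open>G\<^sub>i\<close> onto the \<open>i\<close>-th summand of the second decomposition
  kills, so \<open>G\<^sub>i (F\<^sub>i v) = G\<^sub>i v = v\<close>. The remaining terms
  \<open>G\<^sub>h (F\<^sub>h v)\<close>, \<open>h < i\<close>, lie in \<open>X i\<close>, which is the asserted inclusion
  (\<open>sum_component_component_diff\<close>).

  The common filtration, and the directness of the decompositions, follow from two facts:
  \<open>X i \<inter> Y i = 0\<close>, and the subspaces \<open>X (i+1) \<inter> Y i\<close> span \<open>V\<close>. Both come out of
  irreducibility (\<open>opposite_filtrations_if_irreducible\<close>): for every \<open>r\<close> the sum over \<open>i\<close>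
  of \<open>X (i+1) \<inter> Y (i+r)\<close> is invariant under \<open>A\<close> and \<open>A\<^sup>*\<close>, hence \<open>0\<close> or \<open>V\<close>; it is
  \<open>0\<close> for \<open>r = 1\<close>, being inside the proper subspace \<open>Y 1\<close>, and \<open>V\<close> for \<open>r = 0\<close>, as it
  contains \<open>X 1 \<noteq> 0\<close>. Reversing the order of the \<open>E\<^sub>i\<close> yields another tridiagonal
  system, with \<open>Z\<close> in place of \<open>Y\<close> and the same \<open>X\<close>, so a single argument serves both
  decompositions.
\<close>

section \<open>Projections of a direct decomposition\<close>

context vector_space
begin

lemma span_UN_eq_sum:
  assumes "finite I" "\<And>i. i \<in> I \<Longrightarrow> subspace (U i)"
  shows "span (\<Union>i\<in>I. U i) = (\<Sum>i\<in>I. U i)"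
  using assms
proof (induction I rule: finite_induct)
  case empty
  then show ?case by (simp add: set_zero)
next
  case (insert i I)
  have "span (U i \<union> (\<Union>j\<in>I. U j)) = span (U i) + span (\<Union>j\<in>I. U j)"
    unfolding span_Un set_plus_def by blast
  also have "span (U i) = U i"
    using insert.prems by (simp add: span_eq_iff)
  finally show ?case
    using insert by simp
qed

lemma linear_image_span_subset:
  assumes "Vector_Spaces.linear scale scale f" "subspace T" "f ` S \<subseteq> T"
  shows "f ` span S \<subseteq> T"
proof -
  interpret f: Vector_Spaces.linear scale scale f by fact
  have "span S \<subseteq> f -` T"
    using assms(2,3) by (intro span_minimal f.subspace_vimage) (simp_all add: image_subset_iff_subset_vimage)
  then show ?thesis
    by (simp add: image_subset_iff_subset_vimage)
qed

end

locale direct_decomposition = vector_space scale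
  for scale :: "'k::field \<Rightarrow> 'v::ab_group_add \<Rightarrow> 'v" +
  fixes U :: "nat \<Rightarrow> 'v set" and d :: nat
  assumes subspace_U: "i \<le> d \<Longrightarrow> subspace (U i)"
    and sum_U: "(\<Sum>i\<in>{0..d}. U i) = UNIV"
    and indep_U: "\<lbrakk>\<And>i. i \<le> d \<Longrightarrow> u i \<in> U i; (\<Sum>i\<in>{0..d}. u i) = 0; i \<le> d\<rbrakk> \<Longrightarrow> u i = 0"
begin

text \<open>
  All components of a vector are chosen at once, as one family; independence makes the family
  unique on \<open>{0..d}\<close>, so every property below is obtained by exhibiting a family with the
  right sum.
\<close>

definition component :: "'v \<Rightarrow> nat \<Rightarrow> 'v" where
  "component v = (SOME u. (\<forall>h\<in>{0..d}. u h \<in> U h) \<and> (\<Sum>h\<in>{0..d}. u h) = v)"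

lemma component: "(\<forall>h\<in>{0..d}. component v h \<in> U h) \<and> (\<Sum>h\<in>{0..d}. component v h) = v"
proof -
  have "v \<in> (\<Sum>i\<in>{0..d}. U i)"
    by (simp add: sum_U)
  then have "\<exists>u. (\<forall>h\<in>{0..d}. u h \<in> U h) \<and> (\<Sum>h\<in>{0..d}. u h) = v"
    by (auto simp: set_sum_alt)
  then show ?thesis
    unfolding component_def by (rule someI_ex)
qed

lemma component_in: "h \<le> d \<Longrightarrow> component v h \<in> U h"
  and sum_component: "(\<Sum>h\<in>{0..d}. component v h) = v"
  using component by auto

lemma component_eqI:
  assumes "\<And>h. h \<le> d \<Longrightarrow> u h \<in> U h" "(\<Sum>h\<in>{0..d}. u h) = v" "i \<le> d"
  shows "component v i = u i"
proof -
  have "component v i - u i = 0"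
    using assms by (intro indep_U[where u = "\<lambda>h. component v h - u h"])
      (auto simp: sum_subtractf sum_component intro: subspace_diff subspace_U component_in)
  then show ?thesis by simp
qed

lemma component_of_mem:
  assumes "v \<in> U j" "j \<le> d" "i \<le> d"
  shows "component v i = (if i = j then v else 0)"
  using assms by (intro component_eqI) (auto simp: subspace_0 subspace_U)

lemma linear_component:
  assumes "i \<le> d"
  shows "Vector_Spaces.linear scale scale (\<lambda>v. component v i)"
proof unfold_locales
  fix v w
  show "component (v + w) i = component v i + component w i"
    using assms by (intro component_eqI)
      (auto simp: sum.distrib sum_component intro: subspace_add subspace_U component_in)
next
  fix c v
  show "component (scale c v) i = scale c (component v i)"
    using assms by (intro component_eqI)
      (auto simp: scale_sum_right[symmetric] sum_component intro: subspace_scale subspace_U component_in)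
qed

lemma mem_sum_others:
  assumes "j \<in> {0..d} - {i}" "u \<in> U j"
  shows "u \<in> (\<Sum>k\<in>{0..d} - {i}. U k)"
proof -
  have "u \<in> span (\<Union>k\<in>{0..d} - {i}. U k)"
    using assms by (intro span_base) blast
  also have "\<dots> = (\<Sum>k\<in>{0..d} - {i}. U k)"
    by (rule span_UN_eq_sum) (auto simp: subspace_U)
  finally show ?thesis .
qed

lemma is_projection_component:
  assumes "i \<le> d"
  shows "is_projection scale (\<lambda>v. component v i) (U i) (\<Sum>j\<in>{0..d} - {i}. U j)"
  unfolding is_projection_def
proof (intro conjI ballI)
  show "Vector_Spaces.linear scale scale (\<lambda>v. component v i)"
    using assms by (rule linear_component)
  show "range (\<lambda>v. component v i) = U i"
    using assms component_of_mem[of _ i i] by (auto simp: component_in image_iff) metis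
  show "(\<lambda>v. component v i) \<circ> (\<lambda>v. component v i) = (\<lambda>v. component v i)"
    using component_of_mem[OF component_in[OF assms] assms assms] by (simp add: fun_eq_iff)
next
  fix v assume "v \<in> (\<Sum>j\<in>{0..d} - {i}. U j)"
  then obtain u where u: "v = (\<Sum>j\<in>{0..d} - {i}. u j)" "\<And>j. j \<in> {0..d} - {i} \<Longrightarrow> u j \<in> U j"
    by (auto simp: set_sum_alt)
  have "component v i = (if i = i then 0 else u i)"
  proof (rule component_eqI[where u = "\<lambda>j. if j = i then 0 else u j"])
    show "(\<Sum>h\<in>{0..d}. if h = i then 0 else u h) = v"
      using assms by (simp add: u(1) sum.remove[of "{0..d}" i])
  qed (use assms u(2) in \<open>auto intro: subspace_0 subspace_U\<close>)
  then show "component v i = 0" by simp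
qed

lemma projection_eq_component:
  assumes "is_projection scale P (U i) (\<Sum>j\<in>{0..d} - {i}. U j)" "i \<le> d"
  shows "P = (\<lambda>v. component v i)"
proof
  fix v
  interpret P: Vector_Spaces.linear scale scale P
    using assms(1) by (simp add: is_projection_def)
  have kill: "P (component v j) = 0" if "j \<in> {0..d} - {i}" for j
    using assms(1) mem_sum_others[OF that component_in] that by (auto simp: is_projection_def)
  have "component v i \<in> range P"
    using assms component_in[of i v] by (simp add: is_projection_def)
  then have fixes_i: "P (component v i) = component v i"
    using assms(1) by (metis is_projection_def comp_apply rangeE)
  have "P v = (\<Sum>h\<in>{0..d}. P (component v h))"
    by (simp flip: P.sum add: sum_component)
  also have "\<dots> = component v i"
    using assms(2) by (simp add: sum.remove[of "{0..d}" i] kill fixes_i)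
  finally show "P v = component v i" .
qed

text \<open>
  This discharges the definite description in \<^const>\<open>decomp_proj\<close>: afterwards a
  projection is handled through the components of a vector alone.
\<close>

lemma decomp_proj_eq_component:
  assumes "i \<le> d"
  shows "decomp_proj scale d U i = (\<lambda>v. component v i)"
  unfolding decomp_proj_def
  using is_projection_component projection_eq_component assms by (intro the_equality) auto

end

section \<open>Opposite filtrations\<close>

text \<open>
  An ascending filtration \<open>X\<close> and a descending filtration \<open>Y\<close> in general position. The
  index of \<open>X\<close> counts the layers taken from below and that of \<open>Y\<close> the layers dropped, so
  that \<open>X (Suc i)\<close> and \<open>Y i\<close> overlap in the single layer \<open>i\<close>, whereas \<open>X i\<close> and \<open>Y i\<close>
  are complementary.
\<close>

locale opposite_filtrations = vector_space scale
  for scale :: "'k::field \<Rightarrow> 'v::ab_group_add \<Rightarrow> 'v" +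
  fixes X Y :: "nat \<Rightarrow> 'v set" and d :: nat
  assumes subspace_X: "subspace (X i)" and subspace_Y: "subspace (Y i)"
    and mono_X: "i \<le> j \<Longrightarrow> X i \<subseteq> X j" and antimono_Y: "i \<le> j \<Longrightarrow> Y j \<subseteq> Y i"
    and X_Int_Y: "i \<le> d \<Longrightarrow> X i \<inter> Y i = {0}"
    and sum_X_Int_Y: "(\<Sum>i\<in>{0..d}. X (Suc i) \<inter> Y i) = UNIV"
begin

lemma partial_sum_in_X:
  assumes "\<And>h. h < i \<Longrightarrow> u h \<in> X (Suc h)"
  shows "(\<Sum>h<i. u h) \<in> X i"
  using assms mono_X[of "Suc _" i] by (intro subspace_sum subspace_X) (metis Suc_leI lessThan_iff subsetD)

sublocale direct_decomposition scale "\<lambda>i. X (Suc i) \<inter> Y i" d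
proof
  show "subspace (X (Suc i) \<inter> Y i)" for i
    by (intro subspace_inter subspace_X subspace_Y)
  show "(\<Sum>i\<in>{0..d}. X (Suc i) \<inter> Y i) = UNIV"
    by (rule sum_X_Int_Y)
next
  fix u :: "nat \<Rightarrow> 'v" and i
  assume u: "\<And>i. i \<le> d \<Longrightarrow> u i \<in> X (Suc i) \<inter> Y i"
    and sum0: "(\<Sum>i\<in>{0..d}. u i) = 0" and "i \<le> d"
  \<comment> \<open>If the first \<open>n + 1\<close> terms cancel, the last one, which lies in \<open>Y n\<close>, is minus a sum
    of earlier ones and so also lies in \<open>X n\<close>; hence it vanishes.\<close>
  have "\<forall>h<n. u h = 0" if "n \<le> Suc d" "(\<Sum>h<n. u h) = 0" for n
    using that
  proof (induction n)
    case (Suc n)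
    have "u n = - (\<Sum>h<n. u h)"
      using Suc.prems by (simp add: eq_neg_iff_add_eq_0 add.commute)
    moreover have "(\<Sum>h<n. u h) \<in> X n"
      using u Suc.prems by (intro partial_sum_in_X) auto
    ultimately have "u n \<in> X n \<inter> Y n"
      using u[of n] Suc.prems by (auto intro: subspace_neg subspace_X)
    then have "u n = 0"
      using X_Int_Y[of n] Suc.prems by auto
    then show ?case
      using Suc by (auto simp: less_Suc_eq)
  qed simp
  from this[of "Suc d"] show "u i = 0"
    using sum0 \<open>i \<le> d\<close> by (simp add: atLeast0AtMost lessThan_Suc_atMost)
qed

text \<open>
  The components of index at least \<open>i\<close> add up to an element of \<open>Y i\<close>. If \<open>v \<in> X i\<close>, that
  element is also the difference of \<open>v\<close> and the lower components, both in \<open>X i\<close>, so it is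
  \<open>0\<close>; the components then vanish individually because they are unique.
\<close>

lemma component_eq_0_of_X:
  assumes "v \<in> X i" "i \<le> h" "h \<le> d"
  shows "component v h = 0"
proof -
  define w where "w = (\<Sum>h\<in>{i..d}. component v h)"
  have "{0..d} = {..<i} \<union> {i..d}"
    using assms by auto
  then have "(\<Sum>h\<in>{0..d}. component v h) = (\<Sum>h<i. component v h) + w"
    unfolding w_def by (simp only:) (rule sum.union_disjoint, auto)
  then have split: "v = (\<Sum>h<i. component v h) + w"
    by (simp add: sum_component)
  have "(\<Sum>h<i. component v h) \<in> X i"
    using component_in assms by (intro partial_sum_in_X) auto
  then have "v - (\<Sum>h<i. component v h) \<in> X i"
    using assms(1) by (intro subspace_diff subspace_X)
  moreover have "v - (\<Sum>h<i. component v h) = w"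
    by (subst split) simp
  ultimately have "w \<in> X i"
    by simp
  moreover have "w \<in> Y i"
    unfolding w_def using component_in antimono_Y[of i]
    by (intro subspace_sum subspace_Y) fastforce
  ultimately have "w = 0"
    using X_Int_Y[of i] assms by auto
  with split have "v = (\<Sum>h<i. component v h)" by simp
  also have "\<dots> = (\<Sum>h\<in>{0..d}. if h < i then component v h else 0)"
    using assms by (intro sum.mono_neutral_cong_left) auto
  finally have "component v h = (if h < i then component v h else 0)"
    using assms component_in subspace_0[OF subspace_U]
    by (intro component_eqI[where u = "\<lambda>h. if h < i then component v h else 0"]) auto
  then show ?thesis
    using assms by simp
qed

text \<open>
  The partial sums of the decomposition do not depend on \<open>Y\<close>. This is what lets two
  decompositions built on the same \<open>X\<close> be compared.
\<close>

lemma X_eq_sum: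
  assumes "i \<le> d"
  shows "X i = (\<Sum>j<i. X (Suc j) \<inter> Y j)"
proof (intro equalityI subsetI)
  fix v assume "v \<in> X i"
  then have "(\<Sum>h\<in>{0..d}. component v h) = (\<Sum>h<i. component v h)"
    using assms component_eq_0_of_X[of v i] by (intro sum.mono_neutral_right) auto
  then have "v = (\<Sum>h<i. component v h)"
    by (simp add: sum_component)
  then show "v \<in> (\<Sum>j<i. X (Suc j) \<inter> Y j)"
    using component_in[of _ v] assms by (auto simp: set_sum_alt intro!: exI[of _ "component v"])
next
  fix v assume "v \<in> (\<Sum>j<i. X (Suc j) \<inter> Y j)"
  then show "v \<in> X i"
    by (auto simp: set_sum_alt intro: partial_sum_in_X)
qed

end

text \<open>
  Modulo \<open>X i\<close>, each of the maps \<open>F i\<close> and \<open>G i\<close> acts as the identity on \<open>X (Suc i)\<close>,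
  since both decompositions refine the filtration \<open>X\<close>. On \<open>X (Suc i)\<close> the terms of the
  sum above index \<open>i\<close> vanish and those below it land in \<open>X i\<close>.
\<close>

lemma sum_component_component_diff:
  assumes "opposite_filtrations scale X Y d" "opposite_filtrations scale X Z d"
    and "i \<le> d" and "v \<in> X (Suc i) \<inter> Z i"
  defines "F \<equiv> decomp_proj scale d (\<lambda>i. X (Suc i) \<inter> Y i)"
    and "G \<equiv> decomp_proj scale d (\<lambda>i. X (Suc i) \<inter> Z i)"
  shows "(\<Sum>h\<in>{0..d}. G h (F h v)) - v \<in> (\<Sum>j<i. X (Suc j) \<inter> Z j)"
proof -
  interpret F: opposite_filtrations scale X Y d by fact
  interpret G: opposite_filtrations scale X Z d by fact
  have F: "F h = (\<lambda>v. F.component v h)" and G: "G h = (\<lambda>v. G.component v h)" if "h \<le> d" for h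
    unfolding F_def G_def
    using F.decomp_proj_eq_component[OF that] G.decomp_proj_eq_component[OF that] by simp_all
  interpret Gi: Vector_Spaces.linear scale scale "G i"
    using G.linear_component[OF \<open>i \<le> d\<close>] by (simp add: G assms(3))
  have low: "(\<Sum>h<i. F h v) \<in> X i"
    using F.component_in assms(3) by (intro F.partial_sum_in_X) (simp add: F)
  have F_high: "F h v = 0" if "i < h" "h \<le> d" for h
    using F.component_eq_0_of_X[of v "Suc i" h] that assms(4) by (simp add: F)
  have G0: "G h 0 = 0" if "h \<le> d" for h
    using G.component_eq_0_of_X[of 0 0 h] that by (simp add: G F.subspace_0 F.subspace_X)
  have "v = (\<Sum>h\<in>{0..d}. F h v)"
    using F.sum_component[of v] by (simp add: F)
  also have "\<dots> = (\<Sum>h<Suc i. F h v)"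
    using F_high assms(3) by (intro sum.mono_neutral_right) auto
  finally have v: "F i v = v - (\<Sum>h<i. F h v)"
    by (simp add: algebra_simps)
  have "G i (F i v) = G i v - G i (\<Sum>h<i. F h v)"
    unfolding v by (rule Gi.diff)
  also have "G i (\<Sum>h<i. F h v) = 0"
    using G.component_eq_0_of_X[OF low, of i] assms(3) by (simp add: G)
  also have "G i v = v"
    using G.component_of_mem[of v i i] assms(3,4) by (simp add: G)
  finally have top: "G i (F i v) = v" by simp
  have "(\<Sum>h\<in>{0..d}. G h (F h v)) = (\<Sum>h<Suc i. G h (F h v))"
    using F_high G0 assms(3) by (intro sum.mono_neutral_right) auto
  then have "(\<Sum>h\<in>{0..d}. G h (F h v)) - v = (\<Sum>h<i. G h (F h v))"
    by (simp add: top)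
  also have "\<dots> \<in> X i"
    using G.component_in assms(3) by (intro G.partial_sum_in_X) (simp add: G)
  finally show ?thesis
    using G.X_eq_sum[OF assms(3)] by simp
qed

section \<open>Irreducibility makes filtrations opposite\<close>

text \<open>
  The map \<open>A\<close> moves \<open>X\<close> by at most one step and is scalar on the layers of \<open>Y\<close>; the map
  \<open>As\<close> moves \<open>Y\<close> by at most one step and is scalar on the layers of \<open>X\<close>. Hence, up to a scalar multiple of the vector, \<open>A\<close> sends
  \<open>X (i+1) \<inter> Y (i+r)\<close> to the intersection with both indices raised by one, and \<open>As\<close>
  sends it to the one with both lowered. The difference \<open>r\<close> of the indices is preserved, so
  the sum \<open>W r\<close> along one diagonal is invariant.
\<close>

lemma opposite_filtrations_if_irreducible:
  fixes scale :: "'k::field \<Rightarrow> 'v::ab_group_add \<Rightarrow> 'v" and X Y :: "nat \<Rightarrow> 'v set"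
  assumes vs: "vector_space scale"
    and lin: "Vector_Spaces.linear scale scale A" "Vector_Spaces.linear scale scale As"
    and irred: "\<And>W. \<lbrakk>module.subspace scale W; A ` W \<subseteq> W; As ` W \<subseteq> W\<rbrakk> \<Longrightarrow> W = {0} \<or> W = UNIV"
    and sub: "\<And>i. module.subspace scale (X i)" "\<And>i. module.subspace scale (Y i)"
    and mono: "\<And>i j. i \<le> j \<Longrightarrow> X i \<subseteq> X j" "\<And>i j. i \<le> j \<Longrightarrow> Y j \<subseteq> Y i"
    and X0: "X 0 = {0}" and X1: "X 1 \<noteq> {0}"
    and Y0: "Y 0 = UNIV" and Y1: "Y 1 \<noteq> UNIV" and Yd: "Y (Suc d) = {0}"
    and AX: "\<And>i. A ` X i \<subseteq> X (Suc i)"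
    and AY: "\<And>i v. v \<in> Y i \<Longrightarrow> A v - scale (a i) v \<in> Y (Suc i)"
    and AsX: "\<And>i v. v \<in> X (Suc i) \<Longrightarrow> As v - scale (b i) v \<in> X i"
    and AsY: "\<And>i. As ` Y (Suc i) \<subseteq> Y i"
  shows "opposite_filtrations scale X Y d"
proof -
  interpret vector_space scale by fact
  define W where "W r = span (\<Union>i\<in>{0..d}. X (Suc i) \<inter> Y (i + r))" for r
  \<comment> \<open>Indices beyond \<open>d\<close> are harmless because \<open>Y\<close> is \<open>{0}\<close> there; this spares a separate
    treatment of the upper end of the diagonal.\<close>
  have in_W: "v \<in> W r" if "v \<in> X (Suc i)" "v \<in> Y (i + r)" for v i r
  proof (cases "i \<le> d")
    case True
    then show ?thesis
      using that unfolding W_def by (intro span_base) auto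
  next
    case False
    then have "v \<in> Y (Suc d)"
      using mono(2)[of "Suc d" "i + r"] that by auto
    then show ?thesis
      by (simp add: Yd W_def span_zero)
  qed
  have W_cases: "W r = {0} \<or> W r = UNIV" for r
  proof (rule irred)
    show sW: "subspace (W r)"
      by (simp add: W_def)
    have "A v \<in> W r" if v: "v \<in> X (Suc i)" "v \<in> Y (i + r)" for i v
    proof -
      have "scale (a (i + r)) v \<in> X (Suc (Suc i))"
        using mono(1)[of "Suc i" "Suc (Suc i)"] v by (auto intro: subspace_scale sub)
      then have "A v - scale (a (i + r)) v \<in> X (Suc (Suc i))"
        using AX[of "Suc i"] v by (intro subspace_diff sub) auto
      then have "A v - scale (a (i + r)) v \<in> W r"
        using AY[OF v(2)] by (intro in_W[of _ "Suc i"]) auto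
      then have "A v - scale (a (i + r)) v + scale (a (i + r)) v \<in> W r"
        by (intro subspace_add subspace_scale sW in_W[OF v])
      then show ?thesis by simp
    qed
    then show "A ` W r \<subseteq> W r"
      by (subst W_def) (rule linear_image_span_subset[OF lin(1) sW], auto)
    have "As v \<in> W r" if v: "v \<in> X (Suc i)" "v \<in> Y (i + r)" for i v
    proof -
      have diff: "As v - scale (b i) v \<in> W r"
      proof (cases i)
        \<comment> \<open>At the lower end \<open>v\<close> is an eigenvector of \<open>As\<close>, because \<open>X 0 = {0}\<close>.\<close>
        case 0
        then show ?thesis
          using AsX[OF v(1)] by (simp add: X0 W_def span_zero)
      next
        case (Suc k)
        have "scale (b i) v \<in> Y (k + r)"
          using mono(2)[of "k + r" "i + r"] v Suc by (auto intro: subspace_scale sub)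
        then have "As v - scale (b i) v \<in> Y (k + r)"
          using AsY[of "k + r"] v Suc by (intro subspace_diff sub) auto
        then show ?thesis
          using AsX[OF v(1)] Suc by (intro in_W[of _ k]) auto
      qed
      then have "As v - scale (b i) v + scale (b i) v \<in> W r"
        by (intro subspace_add subspace_scale sW in_W[OF v])
      then show ?thesis by simp
    qed
    then show "As ` W r \<subseteq> W r"
      by (subst W_def) (rule linear_image_span_subset[OF lin(2) sW], auto)
  qed
  have "W 1 \<subseteq> Y 1"
    unfolding W_def using mono(2)[of 1] by (intro span_minimal sub) fastforce
  then have W1: "W 1 = {0}"
    using W_cases[of 1] Y1 by auto
  have "X 1 \<subseteq> W 0"
    using in_W[of _ 0 0] by (auto simp: Y0)
  moreover have "0 \<in> X 1"
    by (intro subspace_0 sub)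
  ultimately have W0: "W 0 = UNIV"
    using W_cases[of 0] X1 by auto
  have "X i \<inter> Y i = {0}" for i
  proof (cases i)
    case 0
    then show ?thesis by (simp add: X0 Y0)
  next
    case (Suc k)
    then have "X i \<inter> Y i \<subseteq> {0}"
      using in_W[of _ k 1] W1 by auto
    then show ?thesis
      using sub by (auto intro: subspace_0)
  qed
  moreover have "(\<Sum>i\<in>{0..d}. X (Suc i) \<inter> Y i) = UNIV"
    using W0 unfolding W_def by (subst (asm) span_UN_eq_sum) (auto intro: subspace_inter sub)
  ultimately show ?thesis
    by (simp add: opposite_filtrations_def opposite_filtrations_axioms_def vs sub mono)
qed

section \<open>Filtrations of a tridiagonal system\<close>

text \<open>
  One half of a tridiagonal system: the eigenspaces of \<open>A\<close> in a standard order, on which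
  \<open>B\<close> acts tridiagonally. A tridiagonal system is an instance of it in two ways, with
  the two maps exchanged.
\<close>

locale ordered_eigenspaces = vector_space scale
  for scale :: "'k::field \<Rightarrow> 'v::ab_group_add \<Rightarrow> 'v" +
  fixes A B :: "'v \<Rightarrow> 'v" and E :: "nat \<Rightarrow> 'v \<Rightarrow> 'v" and d :: nat
  assumes linear_A: "Vector_Spaces.linear scale scale A"
    and linear_B: "Vector_Spaces.linear scale scale B"
    and diag: "diagonalizable scale A"
    and idem: "bij_betw E {0..d} (primitive_idempotents scale A)"
    and std: "standard_ordering scale A B d (\<lambda>i. range (E i))"
begin

definition theta :: "nat \<Rightarrow> 'k" where
  "theta i = (SOME \<theta>. range (E i) = eigenspace scale A \<theta> \<and> eigenvalue scale A \<theta>)"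

lemma range_E:
  assumes "i \<le> d"
  shows "range (E i) = eigenspace scale A (theta i) \<and> eigenvalue scale A (theta i)"
proof -
  have "range (E i) \<in> eigenspaces scale A"
    using std assms by (auto simp: standard_ordering_def dest: bij_betw_apply)
  then show ?thesis
    unfolding theta_def eigenspaces_def by - (rule someI_ex, blast)
qed

lemma eigenvector: "i \<le> d \<Longrightarrow> v \<in> range (E i) \<Longrightarrow> A v = scale (theta i) v"
  using range_E[of i] by (auto simp: eigenspace_def)

lemma subspace_range_E:
  assumes "i \<le> d" shows "subspace (range (E i))"
proof -
  interpret A: Vector_Spaces.linear scale scale A by (rule linear_A)
  show ?thesis
    using range_E[OF assms]
    by (auto simp: eigenspace_def subspace_def A.add A.scale A.zero scale_right_distrib scale_left_commute)
qed

lemma range_E_nonzero: "i \<le> d \<Longrightarrow> range (E i) \<noteq> {0}"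
  using range_E[of i] by (auto simp: eigenspace_def eigenvalue_def)

text \<open>
  Indices above \<open>d\<close> are discarded, so that the blocks of \<open>{..<i}\<close> form a filtration indexed
  by all natural numbers, which is constant from \<open>d + 1\<close> on.
\<close>

definition block :: "nat set \<Rightarrow> 'v set" where
  "block J = span (\<Union>j\<in>J \<inter> {0..d}. range (E j))"

lemma subspace_block: "subspace (block J)"
  by (simp add: block_def)

lemma block_mono: "J \<subseteq> K \<Longrightarrow> block J \<subseteq> block K"
  unfolding block_def by (intro span_mono) auto

lemma block_eq_sum: "block J = (\<Sum>j\<in>J \<inter> {0..d}. range (E j))"
  unfolding block_def by (rule span_UN_eq_sum) (auto simp: subspace_range_E)

lemma range_E_subset_block: "j \<in> J \<Longrightarrow> j \<le> d \<Longrightarrow> range (E j) \<subseteq> block J"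
  unfolding block_def by (intro order_trans[OF _ span_superset]) auto

lemma block_empty: "J \<inter> {0..d} = {} \<Longrightarrow> block J = {0}"
  by (simp add: block_def)

lemma block_all:
  assumes "{0..d} \<subseteq> J" shows "block J = UNIV"
proof -
  have "(\<lambda>i. range (E i)) ` {0..d} = eigenspaces scale A"
    using std by (simp add: standard_ordering_def bij_betw_def)
  then have "(\<Union>i\<in>{0..d}. range (E i)) = \<Union>(eigenspaces scale A)"
    by metis
  moreover have "J \<inter> {0..d} = {0..d}"
    using assms by auto
  ultimately show ?thesis
    using diag by (simp add: block_def diagonalizable_def)
qed

text \<open>
  Subtracting the eigenvalue of index \<open>i\<close> annihilates the \<open>i\<close>-th eigenspace and preserves
  the others.
\<close>

lemma block_shift_eigenvalue:
  assumes "v \<in> block J" "J \<inter> {0..d} \<subseteq> insert i K" "i \<le> d"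
  shows "A v - scale (theta i) v \<in> block K"
proof -
  interpret A: Vector_Spaces.linear scale scale A by (rule linear_A)
  have lin: "Vector_Spaces.linear scale scale (\<lambda>v. A v - scale (theta i) v)"
    by unfold_locales (auto simp: A.add A.scale algebra_simps)
  have "(\<lambda>v. A v - scale (theta i) v) ` block J \<subseteq> block K"
    unfolding block_def[of J]
  proof (rule linear_image_span_subset[OF lin subspace_block], clarify)
    fix j w assume j: "j \<in> J" "j \<in> {0..d}"
    have eig: "A (E j w) = scale (theta j) (E j w)"
      using j by (intro eigenvector) auto
    show "A (E j w) - scale (theta i) (E j w) \<in> block K"
    proof (cases "j = i")
      case True
      then show ?thesis
        using eig by (simp add: subspace_0 subspace_block)
    next
      case False
      then have "j \<in> K"
        using j assms(2) by blast
      then have "E j w \<in> block K"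
        using j range_E_subset_block[of j K] by auto
      then show ?thesis
        by (auto simp: eig intro: subspace_diff subspace_scale subspace_block)
    qed
  qed
  then show ?thesis
    using assms(1) by auto
qed

lemma B_block:
  assumes "\<And>j k. \<lbrakk>j \<in> J; j \<le> d; k \<le> d; j \<le> Suc k; k \<le> Suc j\<rbrakk> \<Longrightarrow> k \<in> K"
  shows "B ` block J \<subseteq> block K"
  unfolding block_def[of J]
proof (rule linear_image_span_subset[OF linear_B subspace_block], clarify)
  fix j w assume j: "j \<in> J" "j \<in> {0..d}"
  have "B (E j w) \<in> (if j = 0 then {0} else range (E (j - 1))) + range (E j) +
      (if j = d then {0} else range (E (j + 1)))"
  proof (rule subsetD)
    show "B (E j w) \<in> B ` range (E j)"
      by (intro imageI rangeI)
  qed (use std j in \<open>simp add: standard_ordering_def\<close>)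
  then obtain x y z where B_eq: "B (E j w) = x + y + z"
    and x: "x \<in> (if j = 0 then {0} else range (E (j - 1)))" and y: "y \<in> range (E j)"
    and z: "z \<in> (if j = d then {0} else range (E (j + 1)))"
    by (elim set_plus_elim) auto
  have range_K: "range (E k) \<subseteq> block K" if "k \<le> d" "j \<le> Suc k" "k \<le> Suc j" for k
    using assms[of j k] j that by (intro range_E_subset_block) auto
  have zero: "{0} \<subseteq> block K"
    using subspace_0[OF subspace_block] by simp
  have "(if j = 0 then {0} else range (E (j - 1))) \<subseteq> block K"
    using zero range_K[of "j - 1"] j by simp
  then have "x \<in> block K" using x by (rule subsetD)
  moreover have "y \<in> block K"
    using y range_K[of j] j by auto
  moreover have "(if j = d then {0} else range (E (j + 1))) \<subseteq> block K"
    using zero range_K[of "j + 1"] j by simp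
  then have "z \<in> block K" using z by (rule subsetD)
  ultimately show "B (E j w) \<in> block K"
    unfolding B_eq by (intro subspace_add subspace_block)
qed

text \<open>
  The primitive idempotent \<open>E i\<close> kills every eigenspace but its own, on which it is not
  zero; so the eigenspaces other than the \<open>i\<close>-th cannot span.
\<close>

lemma block_proper:
  assumes "i \<le> d" "i \<notin> J" shows "block J \<noteq> UNIV"
proof
  assume UNIV: "block J = UNIV"
  have "E i \<in> primitive_idempotents scale A"
    using idem assms by (auto dest: bij_betw_apply)
  then have proj: "is_projection scale (E i) (range (E i)) (\<Union>(eigenspaces scale A - {range (E i)}))"
    unfolding primitive_idempotents_def by (elim CollectE bexE) (simp add: is_projection_def)
  have inj: "inj_on (\<lambda>i. range (E i)) {0..d}"
    using std by (simp add: standard_ordering_def bij_betw_def)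
  have "E i ` block J \<subseteq> {0}"
    unfolding block_def
  proof (rule linear_image_span_subset, goal_cases)
    case 1
    show ?case using proj by (simp add: is_projection_def)
  next
    case 3
    show ?case
    proof clarify
      fix j w assume j: "j \<in> J" "j \<in> {0..d}"
      then have "range (E j) \<in> eigenspaces scale A - {range (E i)}"
        using inj_onD[OF inj, of i j] assms range_E[of j] by (auto simp: eigenspaces_def)
      then show "E i (E j w) = 0"
        using proj unfolding is_projection_def by blast
    qed
  qed simp
  then have "range (E i) = {0}"
    by (simp add: UNIV subset_singleton_iff)
  then show False
    using range_E_nonzero[OF assms(1)] by contradiction
qed

end

lemma ordered_eigenspaces_if_td_system:
  assumes "vector_space scale" "td_system scale A E As Es d"
  shows "ordered_eigenspaces scale A As E d" "ordered_eigenspaces scale As A Es d"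
  using assms
  by (auto simp: ordered_eigenspaces_def ordered_eigenspaces_axioms_def td_system_def td_pair_def)

lemma opposite_filtrations_if_td_system:
  fixes scale :: "'k::field \<Rightarrow> 'v::ab_group_add \<Rightarrow> 'v"
  assumes vs: "vector_space scale" and td: "td_system scale A E As Es d"
  shows "opposite_filtrations scale (\<lambda>i. \<Sum>j\<in>{..<i} \<inter> {0..d}. range (Es j))
           (\<lambda>i. \<Sum>j\<in>{i..d}. range (E j)) d"
proof -
  interpret E: ordered_eigenspaces scale A As E d
    using ordered_eigenspaces_if_td_system[OF assms] by simp
  interpret Es: ordered_eigenspaces scale As A Es d
    using ordered_eigenspaces_if_td_system[OF assms] by simp
  have "opposite_filtrations scale (\<lambda>i. Es.block {..<i}) (\<lambda>i. E.block {i..d}) d"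
  proof (rule opposite_filtrations_if_irreducible
      [where A = A and As = As and a = E.theta and b = Es.theta])
    show "\<And>W. \<lbrakk>E.subspace W; A ` W \<subseteq> W; As ` W \<subseteq> W\<rbrakk> \<Longrightarrow> W = {0} \<or> W = UNIV"
      using td unfolding td_system_def td_pair_def by blast
    show "Es.block {..<1} \<noteq> {0}"
      using Es.range_E_subset_block[of 0 "{..<1}"] Es.range_E_nonzero[of 0]
        E.subspace_0[OF Es.subspace_range_E[of 0]] by auto
    show "E.block {0..d} = UNIV" by (rule E.block_all) simp
    show "E.block {1..d} \<noteq> UNIV" by (rule E.block_proper[of 0]) auto
    show "A ` Es.block {..<i} \<subseteq> Es.block {..<Suc i}" for i
      by (rule Es.B_block) auto
    show "As ` E.block {Suc i..d} \<subseteq> E.block {i..d}" for i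
      by (rule E.B_block) auto
    show "A v - scale (E.theta i) v \<in> E.block {Suc i..d}" if "v \<in> E.block {i..d}" for i v
    proof (cases "i \<le> d")
      case True
      with that show ?thesis by (intro E.block_shift_eigenvalue[of v "{i..d}"]) auto
    next
      case False
      then have "v = 0"
        using that by (simp add: E.block_empty)
      interpret A: Vector_Spaces.linear scale scale A by (rule E.linear_A)
      show ?thesis
        by (simp add: \<open>v = 0\<close> A.zero E.subspace_0 E.subspace_block)
    qed
    show "As v - scale (Es.theta i) v \<in> Es.block {..<i}" if "v \<in> Es.block {..<Suc i}" for i v
    proof (cases "i \<le> d")
      case True
      with that show ?thesis by (intro Es.block_shift_eigenvalue[of v "{..<Suc i}"]) auto
    next
      case False
      then show ?thesis by (subst Es.block_all) auto
    qed
  qed (simp_all add: vs E.linear_A Es.linear_A E.subspace_block Es.subspace_block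
      E.block_mono Es.block_mono E.block_empty Es.block_empty)
  moreover have "{i..d} \<inter> {0..d} = {i..d}" for i by auto
  ultimately show ?thesis
    by (simp add: E.block_eq_sum Es.block_eq_sum)
qed

lemma bij_betw_reverse: "bij_betw f {0..d} S \<Longrightarrow> bij_betw (\<lambda>i. f (d - i)) {0..d::nat} S"
  using bij_betw_trans[of "\<lambda>i. d - i" "{0..d}" "{0..d}" f S]
  by (force simp: o_def intro: bij_betw_byWitness[where f' = "\<lambda>i. d - i"])

lemma standard_ordering_reverse:
  assumes "standard_ordering s A B d W"
  shows "standard_ordering s A B d (\<lambda>i. W (d - i))"
  unfolding standard_ordering_def
proof (intro conjI allI impI)
  show "bij_betw (\<lambda>i. W (d - i)) {0..d} (eigenspaces s A)"
    using assms by (intro bij_betw_reverse) (simp add: standard_ordering_def)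
next
  fix i assume i: "i \<le> d"
  have "B ` W (d - i) \<subseteq> (if d - i = 0 then {0} else W (d - i - 1)) + W (d - i) +
      (if d - i = d then {0} else W (d - i + 1))"
    using assms unfolding standard_ordering_def by (meson diff_le_self)
  also have "\<dots> = (if i = 0 then {0} else W (d - (i - 1))) + W (d - i) +
      (if i = d then {0} else W (d - (i + 1)))"
  proof -
    have "d - i = 0 \<longleftrightarrow> i = d" "d - i = d \<longleftrightarrow> i = 0 \<or> d = 0"
      "i \<noteq> 0 \<Longrightarrow> d - i + 1 = d - (i - 1)" "d - i - 1 = d - (i + 1)"
      using i by auto
    then show ?thesis
      using i by (cases "d = 0") (auto simp: ac_simps)
  qed
  finally show "B ` W (d - i) \<subseteq> (if i = 0 then {0} else W (d - (i - 1))) + W (d - i) +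
      (if i = d then {0} else W (d - (i + 1)))" .
qed

text \<open>
  A block tridiagonal shape survives reversing the order of the blocks. Under this symmetry
  the first and second split decompositions are exchanged.
\<close>

lemma td_system_reverse:
  "td_system s A E As Es d \<Longrightarrow> td_system s A (\<lambda>i. E (d - i)) As Es d"
  using standard_ordering_reverse[of s A As d "\<lambda>i. range (E i)"]
  by (simp add: td_system_def bij_betw_reverse)

lemma split2_eq_split1_reverse:
  assumes "i \<le> d"
  shows "split2 E Es d i = split1 (\<lambda>i. E (d - i)) Es d i"
proof -
  have "(\<Sum>j\<in>{0..d - i}. range (E j)) = (\<Sum>j\<in>{i..d}. range (E (d - j)))"
    using assms by (intro sum.reindex_bij_witness[where i = "\<lambda>j. d - j" and j = "\<lambda>j. d - j"]) auto
  then show ?thesis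
    by (simp add: split1_def split2_def)
qed

text \<open>
  The summands of the split decompositions coincide with intersections of the filtrations
  only for indices up to \<open>d\<close>, which are the only ones the projections depend on.
\<close>

lemma decomp_proj_cong:
  assumes "\<And>j. j \<le> d \<Longrightarrow> U j = U' j" "i \<le> d"
  shows "decomp_proj s d U i = decomp_proj s d U' i"
proof -
  have "(\<Sum>j\<in>{0..d} - {i}. U j) = (\<Sum>j\<in>{0..d} - {i}. U' j)"
    using assms by (intro sum.cong) auto
  then show ?thesis
    using assms by (simp add: decomp_proj_def)
qed

theorem lemma9p7:
  fixes scale :: "'k::field \<Rightarrow> 'v::ab_group_add \<Rightarrow> 'v"
    and Basis :: "'v set"
    and A As :: "'v \<Rightarrow> 'v"
    and E Es :: "nat \<Rightarrow> 'v \<Rightarrow> 'v"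
    and d :: nat
  assumes "finite_dimensional_vector_space scale Basis"
    and "vector_space.dim scale (UNIV :: 'v set) > 0"
    and "td_system scale A E As Es d"
    and "d \<ge> 1"
  shows "\<forall>i\<le>d. (\<lambda>v. Delta scale E Es d v - v) ` split2 E Es d i
                 \<subseteq> (\<Sum>j<i. split2 E Es d j)"
proof (intro allI impI image_subsetI)
  fix i v
  assume i: "i \<le> d" and v: "v \<in> split2 E Es d i"
  have vs: "vector_space scale"
    using assms(1) by (simp add: finite_dimensional_vector_space_def)
  define X where "X = (\<lambda>i. \<Sum>j\<in>{..<i} \<inter> {0..d}. range (Es j))"
  define Y where "Y = (\<lambda>i. \<Sum>j\<in>{i..d}. range (E j))"
  define Z where "Z = (\<lambda>i. \<Sum>j\<in>{i..d}. range (E (d - j)))"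
  have opp: "opposite_filtrations scale X Y d" "opposite_filtrations scale X Z d"
    unfolding X_def Y_def Z_def
    using opposite_filtrations_if_td_system[OF vs assms(3)]
      opposite_filtrations_if_td_system[OF vs td_system_reverse[OF assms(3)]] by simp_all
  have "{..<Suc j} \<inter> {0..d} = {0..j}" if "j \<le> d" for j
    using that by auto
  then have split: "split1 E Es d j = X (Suc j) \<inter> Y j" "split2 E Es d j = X (Suc j) \<inter> Z j"
    if "j \<le> d" for j
    using that by (simp_all add: split2_eq_split1_reverse split1_def X_def Y_def Z_def)
  have F: "decomp_proj scale d (split1 E Es d) h = decomp_proj scale d (\<lambda>i. X (Suc i) \<inter> Y i) h"
    "decomp_proj scale d (split2 E Es d) h = decomp_proj scale d (\<lambda>i. X (Suc i) \<inter> Z i) h"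
    if "h \<le> d" for h
    using that split by (auto intro: decomp_proj_cong)
  have "Delta scale E Es d v - v \<in> (\<Sum>j<i. X (Suc j) \<inter> Z j)"
    using sum_component_component_diff[OF opp i, of v] v split[OF i] by (simp add: Delta_def F)
  also have "\<dots> = (\<Sum>j<i. split2 E Es d j)"
    using i split by (intro sum.cong) auto
  finally show "Delta scale E Es d v - v \<in> (\<Sum>j<i. split2 E Es d j)" .
qed

end
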